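(* Let $d\ge1$. If $T=(T_1,\ldots,T_d)$ is a commuting row contraction consisting of $2\times2$ complex matrices, then $$\|p(T)\|\le\sup_{z\in\mathbb{B}_d}|p(z)|$$ for all $p\in\mathbb{C}[z_1,\ldots,z_d]$.
   Context: $\mathbb{B}_d$ is the open Euclidean unit ball of $\mathbb{C}^d$. A tuple $T=(T_1,\ldots,T_d)$ of commuting matrices is a commuting row contraction if $\|\sum_{i=1}^d T_iT_i^*\|^{1/2}\le1$. *)

theory Defs
  imports "HOL-Analysis.Analysis" "HOL-Library.Poly_Mapping"
begin

text \<open>
  The index type \<open>'n\<close> has \<open>d = CARD('n) \<ge> 1\<close> elements. The ring of polynomials
  over the complex numbers in the variables \<open>z\<^sub>i\<close> (\<open>i :: 'n\<close>) is the monoid algebra of the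
  exponent vectors \<open>'n \<Rightarrow>\<^sub>0 nat\<close>.
\<close>

type_synonym 'n cpoly = "('n \<Rightarrow>\<^sub>0 nat) \<Rightarrow>\<^sub>0 complex"

definition eval_point :: "'n::finite cpoly \<Rightarrow> complex^'n \<Rightarrow> complex" where
  "eval_point p z =
     (\<Sum>m\<in>Poly_Mapping.keys p. Poly_Mapping.lookup p m * (\<Prod>i\<in>UNIV. (z $ i) ^ Poly_Mapping.lookup m i))"

text \<open>
  The instances \<open>*\<close>, \<open>^\<close> and \<open>1\<close> on \<open>complex^'k^'k\<close> are componentwise, hence powers and
  monomials are built from \<open>**\<close> and \<open>mat 1\<close>.
\<close>

definition mat_power :: "complex^'k^'k \<Rightarrow> nat \<Rightarrow> complex^'k^'k" where
  "mat_power A n = (((**) A) ^^ n) (mat 1)"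

text \<open>
  The order of the factors of a monomial does not matter if the matrices commute
  (lemma \<open>eval_monom_mat_eq_foldr\<close>); \<open>eval_monom_mat\<close> is only meaningful in that case.
\<close>

definition eval_monom_mat :: "('n::finite \<Rightarrow>\<^sub>0 nat) \<Rightarrow> ('n \<Rightarrow> complex^'k^'k) \<Rightarrow> complex^'k^'k" where
  "eval_monom_mat m T =
     Finite_Set.fold (\<lambda>i A. mat_power (T i) (Poly_Mapping.lookup m i) ** A) (mat 1) UNIV"

definition eval_mat :: "'n::finite cpoly \<Rightarrow> ('n \<Rightarrow> complex^'k^'k) \<Rightarrow> complex^'k^'k" where
  "eval_mat p T =
     (\<Sum>m\<in>Poly_Mapping.keys p. map_matrix ((*) (Poly_Mapping.lookup p m)) (eval_monom_mat m T))"

text \<open>The norm of the type \<open>complex^'k^'k\<close> is the Frobenius norm, not the operator norm.\<close>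

definition op_norm :: "complex^'k^'k \<Rightarrow> real" where
  "op_norm A = onorm ((*v) A)"

definition mat_adj :: "complex^'k^'k \<Rightarrow> complex^'k^'k" where
  "mat_adj A = map_matrix cnj (transpose A)"

definition commuting_row_contraction :: "('n::finite \<Rightarrow> complex^'k^'k) \<Rightarrow> bool" where
  "commuting_row_contraction T \<longleftrightarrow>
     (\<forall>i j. T i ** T j = T j ** T i) \<and>
     sqrt (op_norm (\<Sum>i\<in>UNIV. T i ** mat_adj (T i))) \<le> 1"

lemma mat_power_commute:
  assumes "A ** B = B ** A"
  shows "mat_power A n ** mat_power B k = mat_power B k ** mat_power A n"
proof -
  have 1: "A ** mat_power B k = mat_power B k ** A" if "A ** B = B ** A" for A B :: "complex^'k^'k" and k
    using that
    by (induction k) (simp_all add: mat_power_def matrix_mul_assoc, metis matrix_mul_assoc)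
  have "mat_power B k ** A = A ** mat_power B k"
    using 1[OF assms] by simp
  then show ?thesis
    using 1[of "mat_power B k" A n] by simp
qed

lemma eval_monom_mat_eq_foldr:
  fixes T :: "'n::finite \<Rightarrow> complex^'k^'k"
  assumes "\<And>i j. T i ** T j = T j ** T i" and "distinct xs" and "set xs = UNIV"
  shows "eval_monom_mat m T = foldr (\<lambda>i A. mat_power (T i) (Poly_Mapping.lookup m i) ** A) xs (mat 1)"
proof -
  interpret comp_fun_commute "\<lambda>i A. mat_power (T i) (Poly_Mapping.lookup m i) ** A"
    by standard
      (simp add: fun_eq_iff matrix_mul_assoc mat_power_commute[OF assms(1)])
  have "Finite_Set.fold (\<lambda>i A. mat_power (T i) (Poly_Mapping.lookup m i) ** A) (mat 1) (set xs)
      = foldr (\<lambda>i A. mat_power (T i) (Poly_Mapping.lookup m i) ** A) xs (mat 1)"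
    using assms(2) by (induction xs) simp_all
  then show ?thesis
    by (simp add: eval_monom_mat_def assms(3))
qed

lemma bdd_above_eval_point:
  fixes p :: "'n::finite cpoly"
  shows "bdd_above ((\<lambda>z. cmod (eval_point p z)) ` ball 0 1)"
proof (rule bdd_aboveI2)
  fix z :: "complex^'n"
  assume "z \<in> ball 0 1"
  then have z: "cmod (z $ i) \<le> 1" for i
    using Finite_Cartesian_Product.norm_nth_le[of z i] by simp
  have "cmod (eval_point p z) \<le> (\<Sum>m\<in>Poly_Mapping.keys p. cmod (Poly_Mapping.lookup p m * (\<Prod>i\<in>UNIV. (z $ i) ^ Poly_Mapping.lookup m i)))"
    unfolding eval_point_def by (rule norm_sum)
  also have "\<dots> \<le> (\<Sum>m\<in>Poly_Mapping.keys p. cmod (Poly_Mapping.lookup p m))"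
    by (intro sum_mono)
      (auto simp: norm_mult norm_power z prod_norm[symmetric] intro!: mult_left_le prod_le_1 power_le_one)
  finally show "cmod (eval_point p z) \<le> (\<Sum>m\<in>Poly_Mapping.keys p. cmod (Poly_Mapping.lookup p m))" .
qed

end

theory Submission
  imports Defs "HOL-Complex_Analysis.Conformal_Mappings"
begin

text \<open>
  A commuting family of \<open>2 \<times> 2\<close> matrices spans, together with the identity, an algebra of
  dimension at most two. Hence there is one matrix \<open>S\<close> with \<open>T\<^sub>i = m\<^sub>i I + v\<^sub>i S\<close> for all \<open>i\<close>
  (\<open>commuting_2x2_pencil\<close>), and translating \<open>S\<close> by a scalar makes the vector \<open>m\<close> orthogonal to
  \<open>v\<close>. The cross terms of \<open>\<Sum>\<^sub>i T\<^sub>i T\<^sub>i\<^sup>*\<close> then vanish, so that the row contraction condition reads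
  \<open>|m|\<^sup>2 I + |v|\<^sup>2 S S\<^sup>* \<le> I\<close>. Unless \<open>v = 0\<close> or \<open>|m| = 1\<close>, where
  all \<open>T\<^sub>i\<close> are scalar, \<open>v\<close> can be rescaled to \<open>|m|\<^sup>2 + |v|\<^sup>2 = 1\<close>. Then this says exactly that \<open>S\<close> is a
  contraction, while \<open>z \<mapsto> m + z v\<close> maps the unit disc onto the intersection of the ball with an
  affine complex line. As \<open>p(T) = g(S)\<close> for \<open>g(z) = p(m + z v)\<close>, the claim becomes von Neumann's
  inequality for one \<open>2 \<times> 2\<close> contraction.

  That inequality comes from the Schwarz-Pick lemma. If \<open>(S - a)(S - b) = 0\<close>, then
  \<open>g(S) = g(a) + q(b) (S - a)\<close> with the divided difference \<open>q(z) = (g(z) - g(a)) / (z - a)\<close>.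
  For \<open>|g| < 1\<close> and \<open>w = g(a)\<close>, the maximum principle gives
  \<open>q(b) (1 - cnj(a) b) = k (1 - cnj(w) g(b))\<close> with some \<open>|k| \<le> 1\<close>
  (\<open>schwarz_pick_divided_difference\<close>). In the algebra generated by \<open>S\<close> this scalar identity turns
  into \<open>(g(S) - w) (1 - cnj(a) S) = k (S - a) (1 - cnj(w) g(S))\<close>: the Moebius transform of \<open>g(S)\<close> at \<open>w\<close>
  is \<open>k\<close> times the Moebius transform of \<open>S\<close> at \<open>a\<close>. Moebius transforms preserve and reflect
  contractivity (\<open>contraction_iff_mobius\<close>), which proves that \<open>g(S)\<close> is a contraction
  (\<open>quadratic_contraction_calculus\<close>).

  Schwarz-Pick needs \<open>|a| < 1\<close>, and the maximum principle needs the bound on \<open>g\<close> up to the unit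
  circle, whose image must therefore stay inside the open ball. Both hold for \<open>r T\<close> with \<open>r < 1\<close>
  (\<open>strict_row_contraction_pencil\<close>), and the theorem follows by letting \<open>r\<close> tend to 1.
\<close>

section \<open>The Schwarz-Pick lemma for divided differences\<close>

text \<open>
  The quotient of the Moebius transform of \<open>f\<close> at \<open>f a\<close> by that of \<open>z\<close> at \<open>a\<close> is bounded by 1 on
  the unit circle, where \<open>cmod (z - a) = cmod (1 - cnj a * z)\<close>, hence at \<open>b\<close> by the maximum
  principle. Writing it with the divided difference \<open>q\<close> covers \<open>b = a\<close>, where it bounds the
  derivative \<open>q a\<close>, without a separate case.
\<close>

lemma schwarz_pick_divided_difference:
  fixes f q :: "complex \<Rightarrow> complex"
  assumes f: "f holomorphic_on UNIV" and q: "q holomorphic_on UNIV"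
    and fq: "\<And>z. f z = f a + (z - a) * q z"
    and a: "cmod a < 1" and b: "cmod b \<le> 1"
    and bound: "\<And>z. cmod z \<le> 1 \<Longrightarrow> cmod (f z) < 1"
  obtains k where "cmod k \<le> 1" and "q b * (1 - cnj a * b) = k * (1 - cnj (f a) * f b)"
proof -
  have mob: "(cmod (1 - cnj u * v))\<^sup>2 - (cmod (v - u))\<^sup>2 = (1 - (cmod u)\<^sup>2) * (1 - (cmod v)\<^sup>2)" for u v :: complex
    by (simp only: cmod_power2) (simp add: algebra_simps power2_eq_square)
  have nz: "1 - cnj (f a) * f z \<noteq> 0" if "cmod z \<le> 1" for z
  proof
    assume "1 - cnj (f a) * f z = 0"
    then have "cmod (f a) * cmod (f z) = 1"
      by (metis complex_mod_cnj norm_mult norm_one right_minus_eq)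
    moreover have "cmod (f a) * cmod (f z) < 1 * 1"
      using bound[of a] bound[OF that] a by (intro mult_strict_mono') auto
    ultimately show False by simp
  qed
  define k where "k z = q z * (1 - cnj a * z) / (1 - cnj (f a) * f z)" for z
  have hol: "k holomorphic_on cball 0 1"
    unfolding k_def using nz
    by (intro holomorphic_intros holomorphic_on_subset[OF f] holomorphic_on_subset[OF q]) auto
  have "cmod (k b) \<le> 1"
  proof (rule maximum_modulus_frontier[of k "cball 0 1"])
    show "k holomorphic_on interior (cball 0 1)"
      using hol by (rule holomorphic_on_subset) (rule interior_subset)
    show "continuous_on (closure (cball 0 1)) k"
      using holomorphic_on_imp_continuous_on[OF hol] by simp
    fix z :: complex assume "z \<in> frontier (cball 0 1)"
    then have z: "cmod z = 1" by simp
    have za: "z \<noteq> a" using z a by auto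
    have "(cmod (1 - cnj a * z))\<^sup>2 = (cmod (z - a))\<^sup>2"
      using mob[of a z] z by simp
    then have 1: "cmod (1 - cnj a * z) = cmod (z - a)" by simp
    have "cmod (q z * (z - a)) = cmod (f z - f a)"
      using fq[of z] by (simp add: mult.commute)
    also have "\<dots> \<le> cmod (1 - cnj (f a) * f z)"
    proof (rule power2_le_imp_le)
      have "0 \<le> (1 - (cmod (f a))\<^sup>2) * (1 - (cmod (f z))\<^sup>2)"
        using bound[of a] bound[of z] a z
        by (intro mult_nonneg_nonneg) (auto simp: power_le_one less_imp_le)
      then show "(cmod (f z - f a))\<^sup>2 \<le> (cmod (1 - cnj (f a) * f z))\<^sup>2"
        using mob[of "f a" "f z"] by linarith
    qed simp
    finally show "cmod (k z) \<le> 1"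
      using nz[of z] z by (simp add: k_def norm_divide norm_mult 1 divide_le_eq)
  qed (use b in auto)
  moreover have "q b * (1 - cnj a * b) = k b * (1 - cnj (f a) * f b)"
    using nz[OF b] by (simp add: k_def)
  ultimately show ?thesis by (rule that)
qed

section \<open>Moebius transforms and contractions\<close>

lemma norm_vector_scalar_mult:
  fixes x :: "complex^'k"
  shows "norm (c *s x) = cmod c * norm x"
  by (simp add: norm_vec_def norm_mult L2_set_right_distrib)

lemma norm_mobius_identity:
  fixes x y :: "complex^'k"
  shows "(norm (x - cnj w *s y))\<^sup>2 - (norm (y - w *s x))\<^sup>2 = (1 - (cmod w)\<^sup>2) * ((norm x)\<^sup>2 - (norm y)\<^sup>2)"
proof -
  have "(cmod (u - cnj w * v))\<^sup>2 - (cmod (v - w * u))\<^sup>2 = (1 - (cmod w)\<^sup>2) * ((cmod u)\<^sup>2 - (cmod v)\<^sup>2)" for u v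
    by (simp only: cmod_power2) (simp add: algebra_simps power2_eq_square)
  then show ?thesis
    by (simp add: norm_vec_def L2_set_def sum_nonneg sum_subtractf[symmetric] sum_distrib_left)
qed

text \<open>
  Used with \<open>y = F x\<close> for a matrix \<open>F\<close>: the right-hand side then expresses that the Moebius transform
  \<open>(F - w) (1 - cnj w F)\<^sup>-\<^sup>1\<close> is contractive on the vector \<open>(1 - cnj w F) x\<close>, without forming the
  inverse matrix.
\<close>

lemma contraction_iff_mobius:
  fixes x y :: "complex^'k"
  assumes "cmod w < 1"
  shows "norm y \<le> norm x \<longleftrightarrow> norm (y - w *s x) \<le> norm (x - cnj w *s y)"
proof -
  have "0 < 1 - (cmod w)\<^sup>2"
    using assms by (simp add: power_less_one_iff abs_square_less_1)
  then have "0 \<le> (1 - (cmod w)\<^sup>2) * ((norm x)\<^sup>2 - (norm y)\<^sup>2) \<longleftrightarrow> (norm y)\<^sup>2 \<le> (norm x)\<^sup>2"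
    by (simp add: zero_le_mult_iff)
  then have "(norm y)\<^sup>2 \<le> (norm x)\<^sup>2 \<longleftrightarrow> (norm (y - w *s x))\<^sup>2 \<le> (norm (x - cnj w *s y))\<^sup>2"
    using norm_mobius_identity[of x w y] by linarith
  then show ?thesis by (simp add: power_mono_iff)
qed

lemmas vec_linear = matrix_vector_mult_diff_distrib matrix_vector_right_distrib vector_scalar_commute

text \<open>
  The two Moebius transforms are compared at \<open>y = (1 - cnj a S) x\<close>, which ranges over the whole
  space because \<open>1 - cnj a S\<close> is injective. Everything commutes with \<open>S\<close>, and \<open>S\<close> acts as \<open>b\<close> on
  the range of \<open>S - a\<close>, so that the matrix identity \<open>(F - w) (1 - cnj a S) = k (S - a) (1 - cnj w F)\<close>
  reduces to the scalar identity assumed for \<open>k\<close>.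
\<close>

lemma quadratic_contraction_calculus:
  fixes S F :: "complex^'k^'k"
  assumes S: "\<And>x. norm (S *v x) \<le> norm x" and a: "cmod a < 1" and w: "cmod w < 1"
    and quad: "\<And>x. S *v (S *v x) = (a + b) *s (S *v x) - (a * b) *s x"
    and F: "\<And>x. F *v x = w *s x + q *s (S *v x - a *s x)"
    and k: "cmod k \<le> 1" "q * (1 - cnj a * b) = k * (1 - cnj w * (w + q * (b - a)))"
  shows "norm (F *v y) \<le> norm y"
proof -
  let ?h = "\<lambda>x. x - cnj a *s (S *v x)"
  have "linear ?h"
    by (rule linearI)
      (simp_all add: vec_linear linear_scale[OF matrix_vector_mul_linear] vec_eq_iff algebra_simps)
  moreover have "inj ?h"
  proof (subst linear_injective_0[OF \<open>linear ?h\<close>], intro allI impI)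
    fix x assume "?h x = 0"
    then have "x = cnj a *s (S *v x)" by simp
    then have "norm x = cmod a * norm (S *v x)"
      by (metis complex_mod_cnj norm_vector_scalar_mult)
    also have "\<dots> \<le> cmod a * norm x"
      by (intro mult_left_mono S) auto
    finally have "(1 - cmod a) * norm x \<le> 0" by (simp add: algebra_simps)
    then show "x = 0" using a by (simp add: mult_le_0_iff)
  qed
  ultimately have "surj ?h" by (rule linear_injective_imp_surjective) simp
  then obtain x where y: "y = ?h x" by blast
  define x' where "x' = x - cnj w *s (F *v x)"
  have 1: "F *v y - w *s y = k *s (S *v x' - a *s x')"
  proof -
    have "F *v y - w *s y = (q * (1 - cnj a * b)) *s (S *v x - a *s x)"
      unfolding F y by (simp add: vec_linear quad vec_eq_iff algebra_simps)
    also have "\<dots> = k *s (S *v x' - a *s x')"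
      unfolding k x'_def F by (simp add: vec_linear quad vec_eq_iff algebra_simps)
    finally show ?thesis .
  qed
  have 2: "y - cnj w *s (F *v y) = x' - cnj a *s (S *v x')"
    unfolding F y x'_def by (simp add: vec_linear quad vec_eq_iff algebra_simps)
  have "norm (F *v y - w *s y) \<le> norm (S *v x' - a *s x')"
    unfolding 1 norm_vector_scalar_mult using k(1) by (intro mult_left_le_one_le) auto
  also have "\<dots> \<le> norm (y - cnj w *s (F *v y))"
    unfolding 2 using S contraction_iff_mobius[OF a] by blast
  finally show ?thesis using contraction_iff_mobius[OF w] by blast
qed


section \<open>Functional calculus of a matrix with a quadratic annihilating polynomial\<close>

text \<open>
  For \<open>S\<close> with \<open>(S - a)(S - b) = 0\<close> this expresses \<open>A = g(S)\<close>, in the form of the Newton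
  interpolation of \<open>g\<close> at \<open>a\<close> and \<open>b\<close>: the witness \<open>q\<close> is the divided difference of \<open>g\<close> at \<open>a\<close>.
  Since \<open>q\<close> is entire, \<open>a = b\<close> is allowed, and \<open>q b\<close> is then the derivative of \<open>g\<close> at \<open>a\<close>.
\<close>

definition newton_form ::
  "complex \<Rightarrow> complex \<Rightarrow> complex^'k^'k \<Rightarrow> (complex \<Rightarrow> complex) \<Rightarrow> complex^'k^'k \<Rightarrow> bool" where
  "newton_form a b S g A \<longleftrightarrow> (\<exists>q. q holomorphic_on UNIV \<and> (\<forall>z. g z = g a + (z - a) * q z) \<and>
     (\<forall>x. A *v x = g a *s x + q b *s (S *v x - a *s x)))"

lemma newton_form_const_1: "newton_form a b S (\<lambda>_. 1) (mat 1)"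
  unfolding newton_form_def by (rule exI[of _ "\<lambda>_. 0"]) simp

lemma newton_form_affine:
  assumes "\<And>x. A *v x = m *s x + v *s (S *v x)"
  shows "newton_form a b S (\<lambda>z. m + v * z) A"
  unfolding newton_form_def
  by (rule exI[of _ "\<lambda>_. v"]) (simp add: assms vec_eq_iff algebra_simps)

lemma newton_form_scale:
  assumes "newton_form a b S g A"
  shows "newton_form a b S (\<lambda>z. c * g z) (map_matrix ((*) c) A)"
proof -
  obtain q where q: "q holomorphic_on UNIV" "\<And>z. g z = g a + (z - a) * q z"
    "\<And>x. A *v x = g a *s x + q b *s (S *v x - a *s x)"
    using assms unfolding newton_form_def by blast
  have "map_matrix ((*) c) A *v x = c *s (A *v x)" for x
    by (simp add: vec_eq_iff matrix_vector_mult_def sum_distrib_left mult.assoc)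
  then have "map_matrix ((*) c) A *v x = (c * g a) *s x + (c * q b) *s (S *v x - a *s x)" for x
    by (simp add: q(3) vec_eq_iff distrib_left mult.assoc)
  moreover have "c * g z = c * g a + (z - a) * (c * q z)" for z
    by (subst q(2)[of z]) (simp add: algebra_simps)
  moreover have "(\<lambda>z. c * q z) holomorphic_on UNIV"
    by (intro holomorphic_intros q)
  ultimately show ?thesis
    unfolding newton_form_def
    by (intro exI[of _ "\<lambda>z. c * q z"]) blast
qed

lemma newton_form_sum:
  assumes "finite I" and "\<And>i. i \<in> I \<Longrightarrow> newton_form a b S (g i) (A i)"
  shows "newton_form a b S (\<lambda>z. \<Sum>i\<in>I. g i z) (\<Sum>i\<in>I. A i)"
proof -
  obtain q where q: "\<And>i. i \<in> I \<Longrightarrow> q i holomorphic_on UNIV"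
    "\<And>i z. i \<in> I \<Longrightarrow> g i z = g i a + (z - a) * q i z"
    "\<And>i x. i \<in> I \<Longrightarrow> A i *v x = g i a *s x + q i b *s (S *v x - a *s x)"
    using assms(2) unfolding newton_form_def by metis
  have "(\<Sum>i\<in>I. A i) *v x = (\<Sum>i\<in>I. A i *v x)" for x
    using assms(1) by induction (simp_all add: matrix_vector_mult_add_rdistrib)
  moreover have "(\<Sum>i\<in>I. g i a *s x + q i b *s d) = (\<Sum>i\<in>I. g i a) *s x + (\<Sum>i\<in>I. q i b) *s d" for x d :: "complex^'k"
    by (simp add: sum.distrib vec_eq_iff sum_distrib_right)
  ultimately have "(\<Sum>i\<in>I. A i) *v x = (\<Sum>i\<in>I. g i a) *s x + (\<Sum>i\<in>I. q i b) *s (S *v x - a *s x)" for x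
    by (simp only: q(3) cong: sum.cong)
  moreover have "(\<Sum>i\<in>I. g i z) = (\<Sum>i\<in>I. g i a) + (z - a) * (\<Sum>i\<in>I. q i z)" for z
    by (simp add: sum_distrib_left sum.distrib[symmetric] q(2)[symmetric])
  moreover have "(\<lambda>z. \<Sum>i\<in>I. q i z) holomorphic_on UNIV"
    by (intro holomorphic_intros q)
  ultimately show ?thesis
    unfolding newton_form_def by (intro exI[of _ "\<lambda>z. \<Sum>i\<in>I. q i z"]) blast
qed

text \<open>
  The product rule for divided differences matches the matrix product because
  \<open>(S - a)\<^sup>2 = (b - a) (S - a)\<close>.
\<close>

lemma newton_form_mult:
  assumes quad: "\<And>x. S *v (S *v x) = (a + b) *s (S *v x) - (a * b) *s x"
    and "newton_form a b S g A" and "newton_form a b S h B"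
  shows "newton_form a b S (\<lambda>z. g z * h z) (A ** B)"
proof -
  obtain q where q: "q holomorphic_on UNIV" "\<And>z. g z = g a + (z - a) * q z"
    "\<And>x. A *v x = g a *s x + q b *s (S *v x - a *s x)"
    using assms(2) unfolding newton_form_def by blast
  obtain r where r: "r holomorphic_on UNIV" "\<And>z. h z = h a + (z - a) * r z"
    "\<And>x. B *v x = h a *s x + r b *s (S *v x - a *s x)"
    using assms(3) unfolding newton_form_def by blast
  let ?s = "\<lambda>z. g a * r z + q z * h a + (z - a) * q z * r z"
  have "(A ** B) *v x = (g a * h a) *s x + ?s b *s (S *v x - a *s x)" for x
    unfolding matrix_vector_mul_assoc[symmetric] q(3) r(3)
    by (simp add: vec_linear quad vec_eq_iff algebra_simps)
  moreover have "g z * h z = g a * h a + (z - a) * ?s z" for z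
    by (subst q(2)[of z], subst r(2)[of z]) (simp add: algebra_simps)
  moreover have "?s holomorphic_on UNIV"
    by (intro holomorphic_intros q r)
  ultimately show ?thesis
    unfolding newton_form_def by (intro exI[of _ ?s]) blast
qed

lemma newton_form_power:
  assumes quad: "\<And>x. S *v (S *v x) = (a + b) *s (S *v x) - (a * b) *s x"
    and "newton_form a b S g A"
  shows "newton_form a b S (\<lambda>z. g z ^ n) (mat_power A n)"
proof (induction n)
  case 0
  then show ?case by (simp add: mat_power_def newton_form_const_1)
next
  case (Suc n)
  then show ?case
    using newton_form_mult[OF quad assms(2) Suc] by (simp add: mat_power_def)
qed

lemma newton_form_eval_mat:
  fixes T :: "'n::finite \<Rightarrow> complex^'k^'k" and p :: "'n cpoly"
  assumes quad: "\<And>x. S *v (S *v x) = (a + b) *s (S *v x) - (a * b) *s x"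
    and comm: "\<And>i j. T i ** T j = T j ** T i"
    and T: "\<And>i. newton_form a b S (g i) (T i)"
  shows "newton_form a b S (\<lambda>z. eval_point p (\<chi> i. g i z)) (eval_mat p T)"
proof -
  obtain xs :: "'n list" where xs: "set xs = UNIV" "distinct xs"
    using finite_distinct_list[of "UNIV :: 'n set"] by auto
  have monom: "newton_form a b S (\<lambda>z. \<Prod>i\<in>set ys. g i z ^ Poly_Mapping.lookup m i)
      (foldr (\<lambda>i A. mat_power (T i) (Poly_Mapping.lookup m i) ** A) ys (mat 1))"
    if "distinct ys" for m :: "'n \<Rightarrow>\<^sub>0 nat" and ys
    using that
  proof (induction ys)
    case Nil
    then show ?case by (simp add: newton_form_const_1)
  next
    case (Cons i ys)
    then show ?case
      by (simp add: newton_form_mult[OF quad newton_form_power[OF quad T]])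
  qed
  show ?thesis
    unfolding eval_point_def eval_mat_def eval_monom_mat_eq_foldr[OF comm xs(2,1)]
    using monom[OF xs(2)] xs(1)
    by (intro newton_form_sum newton_form_scale) simp_all
qed

section \<open>Von Neumann's inequality for a matrix with a quadratic annihilating polynomial\<close>

text \<open>
  Schwarz-Pick requires values of modulus strictly less than 1, so \<open>g\<close> is divided by a bound \<open>R\<close>
  slightly larger than \<open>M\<close>.
\<close>

lemma von_neumann_quadratic:
  fixes S A :: "complex^'k^'k"
  assumes S: "\<And>x. norm (S *v x) \<le> norm x"
    and quad: "\<And>x. S *v (S *v x) = (a + b) *s (S *v x) - (a * b) *s x"
    and a: "cmod a < 1" and b: "cmod b \<le> 1"
    and gA: "newton_form a b S g A"
    and bound: "\<And>z. cmod z \<le> 1 \<Longrightarrow> cmod (g z) \<le> M"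
  shows "norm (A *v y) \<le> M * norm y"
proof (cases "y = 0")
  case False
  have strict: "norm (A *v y) \<le> R * norm y" if R: "M < R" for R
  proof -
    have M0: "0 \<le> M" using order_trans[OF norm_ge_zero bound[of 0]] by simp
    have R0: "0 < R" using M0 R by linarith
    let ?f = "\<lambda>z. (1 / complex_of_real R) * g z"
    let ?F = "map_matrix ((*) (1 / complex_of_real R)) A"
    have f1: "cmod (?f z) < 1" if "cmod z \<le> 1" for z
      using bound[OF that] R R0 by (simp add: norm_divide)
    obtain q where q: "q holomorphic_on UNIV" "\<And>z. ?f z = ?f a + (z - a) * q z"
      "\<And>x. ?F *v x = ?f a *s x + q b *s (S *v x - a *s x)"
      using newton_form_scale[OF gA] unfolding newton_form_def by blast
    have eq: "?f = (\<lambda>z. ?f a + (z - a) * q z)"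
      by (rule ext) (rule q(2))
    have hf: "?f holomorphic_on UNIV"
      by (subst eq) (intro holomorphic_intros q)
    obtain k where k: "cmod k \<le> 1" "q b * (1 - cnj a * b) = k * (1 - cnj (?f a) * ?f b)"
      by (rule schwarz_pick_divided_difference[OF hf q(1,2) a b f1])
    have fb: "?f b = ?f a + q b * (b - a)"
      using q(2)[of b] by (simp only: mult.commute)
    have "norm (?F *v y) \<le> norm y"
      by (rule quadratic_contraction_calculus[OF S a _ quad q(3) k(1)])
        (use f1[of a] a k(2)[unfolded fb] in auto)
    moreover have "?F *v y = (1 / complex_of_real R) *s (A *v y)"
      by (simp add: vec_eq_iff matrix_vector_mult_def sum_distrib_left mult.assoc)
    ultimately show ?thesis
      using R0 by (simp add: norm_vector_scalar_mult norm_divide divide_le_eq mult.commute)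
  qed
  have "norm (A *v y) / norm y \<le> M"
  proof (rule dense_ge)
    fix R assume "M < R"
    then show "norm (A *v y) / norm y \<le> R"
      using strict[of R] False by (simp add: divide_le_eq)
  qed
  then show ?thesis using False by (simp add: divide_le_eq)
qed simp

section \<open>Row contractions and adjoints\<close>

text \<open>
  The inner product of the type \<open>complex^'k\<close> is the real part of the Hermitian one.
\<close>

lemma inner_matrix_adj:
  fixes A :: "complex^'k^'k"
  shows "(A *v x) \<bullet> y = x \<bullet> (mat_adj A *v y)"
proof -
  have *: "(u * v) \<bullet> w = v \<bullet> (cnj u * w)" for u v w :: complex
    by (simp add: inner_complex_def algebra_simps)
  show ?thesis
    by (simp add: inner_vec_def matrix_vector_mult_def inner_sum_left inner_sum_right mat_adj_def transpose_def *)
      (rule sum.swap)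
qed

lemma commuting_row_contraction_adj_bound:
  assumes "commuting_row_contraction T"
  shows "(\<Sum>i\<in>UNIV. (norm (mat_adj (T i) *v x))\<^sup>2) \<le> (norm x)\<^sup>2"
proof -
  let ?R = "\<Sum>i\<in>UNIV. T i ** mat_adj (T i)"
  have R: "op_norm ?R \<le> 1"
    using assms by (simp add: commuting_row_contraction_def)
  have "?R *v x = (\<Sum>i\<in>UNIV. T i *v (mat_adj (T i) *v x))"
    unfolding matrix_vector_mul_assoc
    by (induction rule: infinite_finite_induct[where A=UNIV]) (simp_all add: matrix_vector_mult_add_rdistrib)
  then have "(\<Sum>i\<in>UNIV. (norm (mat_adj (T i) *v x))\<^sup>2) = (?R *v x) \<bullet> x"
    by (simp add: inner_sum_left inner_matrix_adj power2_norm_eq_inner)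
  also have "\<dots> \<le> norm (?R *v x) * norm x"
    by (rule norm_cauchy_schwarz)
  also have "\<dots> \<le> (1 * norm x) * norm x"
    using order_trans[OF onorm[OF matrix_vector_mul_bounded_linear, of ?R x]
        mult_right_mono[OF R[unfolded op_norm_def] norm_ge_zero[of x]]]
    by (intro mult_right_mono) auto
  finally show ?thesis by (simp add: power2_eq_square)
qed

text \<open>
  The row contraction condition bounds the adjoint of \<open>S\<close>, but von Neumann's inequality asks for a
  bound on \<open>S\<close> itself.
\<close>

lemma norm_matrix_le_adj:
  fixes A :: "complex^'k^'k"
  assumes "\<And>x. norm (mat_adj A *v x) \<le> c * norm x"
  shows "norm (A *v x) \<le> c * norm x"
proof (cases "A *v x = 0")
  case True
  have "0 \<le> c * norm x" using assms[of x] norm_ge_zero order_trans by blast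
  then show ?thesis using True by simp
next
  case False
  have "norm (A *v x) * norm (A *v x) = x \<bullet> (mat_adj A *v (A *v x))"
    by (metis inner_matrix_adj power2_eq_square power2_norm_eq_inner)
  also have "\<dots> \<le> norm x * norm (mat_adj A *v (A *v x))"
    by (rule norm_cauchy_schwarz)
  also have "\<dots> \<le> norm x * (c * norm (A *v x))"
    by (intro mult_left_mono assms) simp
  finally have "norm (A *v x) * norm (A *v x) \<le> (c * norm x) * norm (A *v x)"
    by (simp add: ac_simps)
  then show ?thesis using False by (simp add: mult_le_cancel_right)
qed

section \<open>Commuting families of two by two matrices\<close>

lemma eigenvalues_cayley_hamilton_2x2:
  fixes S :: "complex^2^2"
  obtains a b where "\<And>x. S *v (S *v x) = (a + b) *s (S *v x) - (a * b) *s x"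
    and "\<exists>x. x \<noteq> 0 \<and> S *v x = a *s x" and "\<exists>x. x \<noteq> 0 \<and> S *v x = b *s x"
proof -
  define t where "t = S$1$1 + S$2$2"
  define d where "d = S$1$1 * S$2$2 - S$1$2 * S$2$1"
  define r where "r = csqrt (t\<^sup>2 - 4 * d)"
  have r2: "r * r = t * t - 4 * d"
    using power2_csqrt[of "t\<^sup>2 - 4 * d"] by (simp add: r_def power2_eq_square)
  define a where "a = (t + r) / 2"
  define b where "b = (t - r) / 2"
  have ab: "a + b = t" "a * b = d"
    using r2 by (simp_all add: a_def b_def field_simps)
  have CH: "S *v (S *v x) = (a + b) *s (S *v x) - (a * b) *s x" for x
    unfolding ab by (simp add: vec_eq_iff forall_2 matrix_vector_mult_def sum_2 t_def d_def algebra_simps)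
  have eig: "\<exists>x. x \<noteq> 0 \<and> S *v x = c *s x" if c: "c * c = t * c - d" for c
  proof (rule ccontr)
    assume none: "\<not> ?thesis"
    have "\<forall>x. (S - mat c) *v x = 0 \<longrightarrow> x = 0"
    proof (intro allI impI)
      fix x assume "(S - mat c) *v x = 0"
      then have "S *v x = c *s x"
        by (simp add: vec_eq_iff forall_2 matrix_vector_mult_def sum_2 mat_def algebra_simps)
      then show "x = 0" using none by blast
    qed
    then have "invertible (S - mat c)"
      by (simp add: invertible_left_inverse matrix_left_invertible_ker)
    then have "det (S - mat c) \<noteq> 0"
      by (simp add: invertible_det_nz)
    moreover have "det (S - mat c) = 0"
      using c by (simp add: det_2 mat_def t_def d_def algebra_simps)
    ultimately show False by simp
  qed
  have "a * a = t * a - d" "b * b = t * b - d"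
    by (simp_all flip: ab add: algebra_simps)
  with CH eig show ?thesis by (intro that) blast+
qed

text \<open>
  The commutator of two \<open>2 \<times> 2\<close> matrices depends only on the vectors formed by the difference of
  the diagonal entries and by the two off-diagonal entries, and vanishes exactly when their cross product does. So these
  vectors are pairwise parallel in a commuting family, and all are multiples of any nonzero one
  among them.
\<close>

lemma commuting_2x2_pencil:
  fixes T :: "'n \<Rightarrow> complex^2^2"
  assumes comm: "\<And>i j. T i ** T j = T j ** T i"
  obtains \<alpha> \<mu> N where "\<And>i. T i = mat (\<alpha> i) + map_matrix ((*) (\<mu> i)) N"
proof -
  let ?d = "\<lambda>i. T i $ 1 $ 1 - T i $ 2 $ 2"
  let ?q = "\<lambda>i. T i $ 1 $ 2"
  let ?r = "\<lambda>i. T i $ 2 $ 1"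
  have rel: "?q i * ?r j = ?q j * ?r i" "?q i * ?d j = ?q j * ?d i" "?r i * ?d j = ?r j * ?d i" for i j
  proof -
    have "(T i ** T j) $ k $ l = (T j ** T i) $ k $ l" for k l
      by (simp add: comm)
    from this[of 1 1] this[of 1 2] this[of 2 1]
    show "?q i * ?r j = ?q j * ?r i" "?q i * ?d j = ?q j * ?d i" "?r i * ?d j = ?r j * ?d i"
      unfolding matrix_matrix_mult_def by (simp_all add: sum_2) algebra+
  qed
  show ?thesis
  proof (cases "\<exists>k. ?d k \<noteq> 0 \<or> ?q k \<noteq> 0 \<or> ?r k \<noteq> 0")
    case False
    then have "T i = mat (T i $ 2 $ 2) + map_matrix ((*) 0) 0" for i
      by (simp add: vec_eq_iff forall_2 mat_def)
    then show ?thesis by (rule that)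
  next
    case True
    then obtain k where k: "?d k \<noteq> 0 \<or> ?q k \<noteq> 0 \<or> ?r k \<noteq> 0" by blast
    have "\<exists>l. ?d i = l * ?d k \<and> ?q i = l * ?q k \<and> ?r i = l * ?r k" for i
    proof -
      consider "?d k \<noteq> 0" | "?q k \<noteq> 0" | "?r k \<noteq> 0" using k by blast
      then show ?thesis
      proof cases
        case 1
        then show ?thesis using rel[of i k]
          by (intro exI[of _ "?d i / ?d k"]) (simp add: eq_divide_eq mult.commute)
      next
        case 2
        then show ?thesis using rel[of i k]
          by (intro exI[of _ "?q i / ?q k"]) (simp add: eq_divide_eq mult.commute)
      next
        case 3
        then show ?thesis using rel[of i k]
          by (intro exI[of _ "?r i / ?r k"]) (simp add: eq_divide_eq mult.commute)
      qed
    qed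
    then obtain l where l: "\<And>i. ?d i = l i * ?d k" "\<And>i. ?q i = l i * ?q k" "\<And>i. ?r i = l i * ?r k"
      by metis
    have "T i = mat (T i $ 2 $ 2 - l i * T k $ 2 $ 2) + map_matrix ((*) (l i)) (T k)" for i
      using l[of i] by (simp add: vec_eq_iff forall_2 mat_def algebra_simps)
    then show ?thesis by (rule that)
  qed
qed


section \<open>The affine disc through a strict row contraction\<close>

lemma pythagoras_pencil:
  fixes m v :: "'n::finite \<Rightarrow> complex" and x y :: "complex^'k"
  assumes orth: "(\<Sum>i\<in>UNIV. m i * cnj (v i)) = 0"
  shows "(\<Sum>i\<in>UNIV. (norm (m i *s x + v i *s y))\<^sup>2)
    = (\<Sum>i\<in>UNIV. (cmod (m i))\<^sup>2) * (norm x)\<^sup>2 + (\<Sum>i\<in>UNIV. (cmod (v i))\<^sup>2) * (norm y)\<^sup>2"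
proof -
  have 1: "(cmod (c * z + d * w))\<^sup>2
      = (cmod c)\<^sup>2 * (cmod z)\<^sup>2 + (cmod d)\<^sup>2 * (cmod w)\<^sup>2 + 2 * Re (c * cnj d * (z * cnj w))" for c d z w
    by (simp only: cmod_power2) (simp add: algebra_simps power2_eq_square)
  have 2: "(\<Sum>i\<in>UNIV. Re (m i * cnj (v i) * c)) = 0" for c
  proof -
    have "(\<Sum>i\<in>UNIV. Re (m i * cnj (v i) * c)) = Re ((\<Sum>i\<in>UNIV. m i * cnj (v i)) * c)"
      by (simp only: Re_sum sum_distrib_right)
    then show ?thesis using orth by simp
  qed
  have 3: "(\<Sum>i\<in>UNIV. (cmod (m i * z + v i * w))\<^sup>2)
      = (\<Sum>i\<in>UNIV. (cmod (m i))\<^sup>2) * (cmod z)\<^sup>2 + (\<Sum>i\<in>UNIV. (cmod (v i))\<^sup>2) * (cmod w)\<^sup>2" for z w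
    by (simp only: 1 sum.distrib 2 mult_zero_right add_0_right flip: sum_distrib_left sum_distrib_right)
  have nv: "(norm u)\<^sup>2 = (\<Sum>j\<in>UNIV. (cmod (u $ j))\<^sup>2)" for u :: "complex^'k"
    by (simp add: norm_vec_def L2_set_def sum_nonneg)
  have "(\<Sum>i\<in>UNIV. (norm (m i *s x + v i *s y))\<^sup>2)
      = (\<Sum>j\<in>UNIV. \<Sum>i\<in>UNIV. (cmod (m i * x $ j + v i * y $ j))\<^sup>2)"
    unfolding nv by (subst sum.swap) simp
  also have "\<dots> = (\<Sum>i\<in>UNIV. (cmod (m i))\<^sup>2) * (norm x)\<^sup>2 + (\<Sum>i\<in>UNIV. (cmod (v i))\<^sup>2) * (norm y)\<^sup>2"
    unfolding 3 nv by (simp add: sum.distrib sum_distrib_left)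
  finally show ?thesis .
qed

text \<open>
  Strictness of the row contraction (\<open>c < 1\<close>) leaves room to choose the length of \<open>v\<close> such that
  the operator norm of \<open>S\<close> is less than 1 and the closed disc of the points \<open>m + z v\<close> with
  \<open>cmod z \<le> 1\<close> lies in the open ball.
\<close>

lemma strict_row_contraction_pencil:
  fixes T :: "'n::finite \<Rightarrow> complex^2^2"
  assumes comm: "\<And>i j. T i ** T j = T j ** T i"
    and row: "\<And>x. (\<Sum>i\<in>UNIV. (norm (mat_adj (T i) *v x))\<^sup>2) \<le> c * (norm x)\<^sup>2"
    and c: "c < 1"
  obtains m v S s where "\<forall>i x. T i *v x = m i *s x + v i *s (S *v x)"
    and "\<forall>z. cmod z \<le> 1 \<longrightarrow> norm (\<chi> i. m i + v i * z) < 1"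
    and "s < 1" and "\<forall>x. norm (S *v x) \<le> s * norm x"
proof -
  obtain \<alpha> \<mu> N where T: "\<And>i. T i = mat (\<alpha> i) + map_matrix ((*) (\<mu> i)) N"
    using commuting_2x2_pencil[of T, OF comm] by metis
  define L where "L = (\<Sum>i\<in>UNIV. (cmod (\<mu> i))\<^sup>2)"
  have L0: "0 \<le> L" by (simp add: L_def sum_nonneg)
  have L: "(\<Sum>i\<in>UNIV. \<mu> i * cnj (\<mu> i)) = of_real L"
    by (simp add: L_def complex_norm_square[symmetric])
  have L_zero: "\<mu> i = 0" if "L = 0" for i
    using that by (simp add: L_def sum_nonneg_eq_0_iff)
  \<comment> \<open>The shift by \<open>t\<close> makes \<open>m\<close> orthogonal to \<open>\<mu>\<close>. If \<open>\<mu> = 0\<close>, then \<open>t = 0\<close> because division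
    by zero yields zero, and \<open>m = \<alpha>\<close> is orthogonal to \<open>\<mu>\<close> anyway.\<close>
  define t where "t = (\<Sum>i\<in>UNIV. \<alpha> i * cnj (\<mu> i)) / of_real L"
  define m where "m i = \<alpha> i - t * \<mu> i" for i
  define N' where "N' = N + mat t"
  have "(\<Sum>i\<in>UNIV. m i * cnj (\<mu> i)) = (\<Sum>i\<in>UNIV. \<alpha> i * cnj (\<mu> i)) - t * of_real L"
    by (simp add: m_def algebra_simps sum_subtractf sum_distrib_left flip: L)
  also have "\<dots> = 0"
    by (cases "L = 0") (simp_all add: t_def L_zero)
  finally have orth: "(\<Sum>i\<in>UNIV. m i * cnj (\<mu> i)) = 0" .
  have T': "T i *v x = m i *s x + \<mu> i *s (N' *v x)" for i x
    by (simp add: T m_def N'_def vec_eq_iff forall_2 matrix_vector_mult_def sum_2 mat_def algebra_simps)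
  have adj: "mat_adj (T i) *v x = cnj (m i) *s x + cnj (\<mu> i) *s (mat_adj N' *v x)" for i x
    by (simp add: T m_def N'_def mat_adj_def transpose_def vec_eq_iff forall_2
        matrix_vector_mult_def sum_2 mat_def algebra_simps)
  define K where "K = (\<Sum>i\<in>UNIV. (cmod (m i))\<^sup>2)"
  have "(\<Sum>i\<in>UNIV. cnj (m i) * cnj (cnj (\<mu> i))) = cnj (\<Sum>i\<in>UNIV. m i * cnj (\<mu> i))"
    by simp
  then have orth': "(\<Sum>i\<in>UNIV. cnj (m i) * cnj (cnj (\<mu> i))) = 0"
    using orth by simp
  have KL: "K * (norm x)\<^sup>2 + L * (norm (mat_adj N' *v x))\<^sup>2 \<le> c * (norm x)\<^sup>2" for x
    using row[of x] pythagoras_pencil[OF orth', of x "mat_adj N' *v x"]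
    by (simp add: adj K_def L_def)
  \<comment> \<open>Pythagoras for the point \<open>m + w \<mu>\<close> of the line, whose coordinates are read as vectors of
    length one.\<close>
  have norm_point: "(norm (\<chi> i. m i + w * \<mu> i))\<^sup>2 = K + L * (cmod w)\<^sup>2" for w
  proof -
    have "(norm (\<chi> i. m i + w * \<mu> i))\<^sup>2 = (\<Sum>i\<in>UNIV. (norm (m i *s (1::complex^1) + \<mu> i *s (w *s (1::complex^1))))\<^sup>2)"
      by (simp add: norm_vec_def L2_set_def sum_nonneg mult.commute)
    also have "\<dots> = K + L * (cmod w)\<^sup>2"
      using pythagoras_pencil[OF orth, of 1 "w *s (1::complex^1)"] by (simp add: K_def L_def norm_vec_def L2_set_def)
    finally show ?thesis .
  qed
  have Kc: "K \<le> c"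
  proof -
    let ?e = "axis 1 1 :: complex^2"
    have "K * (norm ?e)\<^sup>2 \<le> c * (norm ?e)\<^sup>2"
      using KL[of ?e] L0 by (smt (verit) mult_nonneg_nonneg zero_le_power2)
    then show ?thesis by (simp add: norm_axis_1)
  qed
  show ?thesis
  proof (cases "L = 0")
    case True
    show ?thesis
    proof (rule that[of m "\<lambda>_. 0" 0 0])
      show "\<forall>i x. T i *v x = m i *s x + 0 *s (0 *v x)"
        by (simp add: T' L_zero[OF True])
      have "(norm (\<chi> i. m i))\<^sup>2 < 1"
        using norm_point[of 0] Kc c by simp
      then show "\<forall>z. cmod z \<le> 1 \<longrightarrow> norm (\<chi> i. m i + 0 * z) < 1"
        by (simp add: abs_square_less_1)
    qed auto
  next
    case False
    then have L_pos: "0 < L" using L0 by simp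
    \<comment> \<open>The number \<open>\<kappa>\<close> is the squared length of the rescaled direction \<open>h \<mu>\<close>. Row contractivity gives
      \<open>\<kappa> * norm (S\<^sup>* x)\<^sup>2 \<le> (c - K) * norm x\<^sup>2\<close>, so \<open>\<kappa> > c - K\<close> makes \<open>S\<close> a strict contraction, and
      \<open>\<kappa> < 1 - K\<close> keeps the disc inside the ball; \<open>\<kappa>\<close> is the midpoint.\<close>
    define \<kappa> where "\<kappa> = (c + 1) / 2 - K"
    have \<kappa>: "0 < \<kappa>" "c - K < \<kappa>" using Kc c by (simp_all add: \<kappa>_def field_simps)
    define h where "h = sqrt (\<kappa> / L)"
    have h: "0 < h" "L * h\<^sup>2 = \<kappa>" using \<kappa> L_pos by (simp_all add: h_def)
    define S where "S = map_matrix ((*) (1 / of_real h)) N'"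
    have S: "S *v x = (1 / of_real h) *s (N' *v x)"
        "mat_adj S *v x = (1 / of_real h) *s (mat_adj N' *v x)" for x
      by (simp_all add: S_def mat_adj_def transpose_def vec_eq_iff forall_2
          matrix_vector_mult_def sum_2 add_divide_distrib)
    define s where "s = sqrt ((c - K) / \<kappa>)"
    show ?thesis
    proof (rule that[of m "\<lambda>i. of_real h * \<mu> i" S s])
      show "\<forall>i x. T i *v x = m i *s x + (of_real h * \<mu> i) *s (S *v x)"
        using h(1) by (simp add: T' S vec_eq_iff)
      show "\<forall>z. cmod z \<le> 1 \<longrightarrow> norm (\<chi> i. m i + of_real h * \<mu> i * z) < 1"
      proof (intro allI impI)
        fix z :: complex assume z: "cmod z \<le> 1"
        have "(norm (\<chi> i. m i + (of_real h * z) * \<mu> i))\<^sup>2 = K + \<kappa> * (cmod z)\<^sup>2"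
          unfolding norm_point by (simp add: norm_mult power_mult_distrib flip: h(2))
        also have "\<dots> \<le> K + \<kappa> * 1"
          using z \<kappa>(1) by (intro add_left_mono mult_left_mono) (auto simp: power_le_one)
        also have "\<dots> < 1" using c by (simp add: \<kappa>_def)
        finally show "norm (\<chi> i. m i + of_real h * \<mu> i * z) < 1"
          by (simp add: abs_square_less_1 ac_simps)
      qed
      show "s < 1" using \<kappa> by (simp add: s_def)
      have "norm (mat_adj S *v x) \<le> s * norm x" for x
      proof (rule power2_le_imp_le)
        have "\<kappa> * (norm (mat_adj S *v x))\<^sup>2 = L * (norm (mat_adj N' *v x))\<^sup>2"
          using h(1) by (simp add: S norm_vector_scalar_mult norm_divide power_divide flip: h(2))
        then have "\<kappa> * (norm (mat_adj S *v x))\<^sup>2 \<le> (c - K) * (norm x)\<^sup>2"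
          using KL[of x] by (simp add: algebra_simps)
        then have "(norm (mat_adj S *v x))\<^sup>2 \<le> (c - K) / \<kappa> * (norm x)\<^sup>2"
          using \<kappa>(1) by (simp add: field_simps)
        then show "(norm (mat_adj S *v x))\<^sup>2 \<le> (s * norm x)\<^sup>2"
          using Kc \<kappa>(1) by (simp add: s_def power_mult_distrib)
        show "0 \<le> s * norm x" using Kc \<kappa>(1) by (simp add: s_def)
      qed
      then have "norm (S *v x) \<le> s * norm x" for x
        by (rule norm_matrix_le_adj)
      then show "\<forall>x. norm (S *v x) \<le> s * norm x" by blast
    qed
  qed
qed

lemma von_neumann_strict_row_contraction:
  fixes T :: "'n::finite \<Rightarrow> complex^2^2" and p :: "'n cpoly"
  assumes comm: "\<And>i j. T i ** T j = T j ** T i"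
    and row: "\<And>x. (\<Sum>i\<in>UNIV. (norm (mat_adj (T i) *v x))\<^sup>2) \<le> c * (norm x)\<^sup>2"
    and c: "c < 1"
  shows "norm (eval_mat p T *v y) \<le> (SUP z\<in>ball (0 :: complex^'n) 1. cmod (eval_point p z)) * norm y"
proof -
  obtain m v S s where T: "\<forall>i x. T i *v x = m i *s x + v i *s (S *v x)"
    and ball: "\<forall>z. cmod z \<le> 1 \<longrightarrow> norm (\<chi> i. m i + v i * z) < 1"
    and s: "s < 1" and S: "\<forall>x. norm (S *v x) \<le> s * norm x"
    by (rule strict_row_contraction_pencil[of T, OF comm row c])
  obtain a b where quad: "\<And>x. S *v (S *v x) = (a + b) *s (S *v x) - (a * b) *s x"
    and eig: "\<exists>x. x \<noteq> 0 \<and> S *v x = a *s x" "\<exists>x. x \<noteq> 0 \<and> S *v x = b *s x"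
    using eigenvalues_cayley_hamilton_2x2[of S] by metis
  have small: "cmod e < 1" if "\<exists>x. x \<noteq> 0 \<and> S *v x = e *s x" for e
  proof -
    from that obtain x where x: "x \<noteq> 0" "S *v x = e *s x" by blast
    have "cmod e * norm x \<le> s * norm x"
      using S[rule_format, of x] x by (simp add: norm_vector_scalar_mult)
    then show ?thesis using x s by (simp add: mult_le_cancel_right)
  qed
  have "norm (S *v x) \<le> norm x" for x
    using S[rule_format, of x] s mult_right_mono[of s 1 "norm x"] by simp
  moreover have "newton_form a b S (\<lambda>z. eval_point p (\<chi> i. m i + v i * z)) (eval_mat p T)"
    by (intro newton_form_eval_mat[OF quad comm] newton_form_affine T[rule_format])
  moreover have "cmod (eval_point p (\<chi> i. m i + v i * z))
      \<le> (SUP z\<in>ball (0 :: complex^'n) 1. cmod (eval_point p z))" if "cmod z \<le> 1" for z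
    using ball[rule_format, OF that] by (intro cSUP_upper bdd_above_eval_point) simp
  ultimately show ?thesis
    using small[OF eig(1)] small[OF eig(2)] quad
    by (intro von_neumann_quadratic[of S a b]) auto
qed

section \<open>Approximation by strict row contractions\<close>

lemma eval_monom_mat_scaleR:
  fixes T :: "'n::finite \<Rightarrow> complex^'k^'k"
  assumes comm: "\<And>i j. T i ** T j = T j ** T i"
  shows "eval_monom_mat m (\<lambda>i. r *\<^sub>R T i)
    = r ^ (\<Sum>i\<in>UNIV. Poly_Mapping.lookup m i) *\<^sub>R eval_monom_mat m T"
proof -
  obtain xs :: "'n list" where xs: "set xs = UNIV" "distinct xs"
    using finite_distinct_list[of "UNIV :: 'n set"] by auto
  have comm': "(r *\<^sub>R T i) ** (r *\<^sub>R T j) = (r *\<^sub>R T j) ** (r *\<^sub>R T i)" for i j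
    by (simp add: matrix_scalar_ac comm flip: scalar_matrix_assoc)
  have power: "mat_power (r *\<^sub>R A) n = r ^ n *\<^sub>R mat_power A n" for A :: "complex^'k^'k" and n
    by (induction n) (simp_all add: mat_power_def matrix_scalar_ac flip: scalar_matrix_assoc)
  have "foldr (\<lambda>i A. mat_power (r *\<^sub>R T i) (Poly_Mapping.lookup m i) ** A) ys (mat 1)
      = r ^ (\<Sum>i\<in>set ys. Poly_Mapping.lookup m i) *\<^sub>R
        foldr (\<lambda>i A. mat_power (T i) (Poly_Mapping.lookup m i) ** A) ys (mat 1)"
    if "distinct ys" for ys
    using that
    by (induction ys) (simp_all add: power power_add matrix_scalar_ac flip: scalar_matrix_assoc)
  from this[OF xs(2)] show ?thesis
    unfolding eval_monom_mat_eq_foldr[OF comm xs(2,1)] eval_monom_mat_eq_foldr[OF comm' xs(2,1)] xs(1) .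
qed

lemma tendsto_eval_mat_dilation:
  fixes T :: "'n::finite \<Rightarrow> complex^'k^'k" and p :: "'n cpoly"
  assumes comm: "\<And>i j. T i ** T j = T j ** T i"
  shows "((\<lambda>r. eval_mat p (\<lambda>i. r *\<^sub>R T i) *v x) \<longlongrightarrow> eval_mat p T *v x) (at_left 1)"
proof -
  let ?X = "\<lambda>m. map_matrix ((*) (Poly_Mapping.lookup p m)) (eval_monom_mat m T)"
  have eq: "eval_mat p (\<lambda>i. r *\<^sub>R T i)
      = (\<Sum>m\<in>Poly_Mapping.keys p. r ^ (\<Sum>i\<in>UNIV. Poly_Mapping.lookup m i) *\<^sub>R ?X m)" for r
    unfolding eval_mat_def eval_monom_mat_scaleR[OF comm]
    by (intro sum.cong refl) (simp add: vec_eq_iff)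
  have "((\<lambda>r. eval_mat p (\<lambda>i. r *\<^sub>R T i)) \<longlongrightarrow>
      (\<Sum>m\<in>Poly_Mapping.keys p. 1 ^ (\<Sum>i\<in>UNIV. Poly_Mapping.lookup m i) *\<^sub>R ?X m)) (at_left (1::real))"
    unfolding eq by (intro tendsto_intros)
  then have lim: "((\<lambda>r. eval_mat p (\<lambda>i. r *\<^sub>R T i)) \<longlongrightarrow> eval_mat p T) (at_left (1::real))"
    by (simp add: eval_mat_def)
  show ?thesis
    unfolding matrix_vector_mult_def
    by (intro vec_tendstoI) (simp, intro tendsto_intros tendsto_vec_nth lim)
qed

theorem corollary3p4:
  fixes T :: "'n::finite \<Rightarrow> complex^2^2" and p :: "'n cpoly"
  assumes "commuting_row_contraction T"
  shows "op_norm (eval_mat p T) \<le> (SUP z\<in>ball (0 :: complex^'n) 1. cmod (eval_point p z))"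
    (is "_ \<le> ?M")
proof -
  have comm: "T i ** T j = T j ** T i" for i j
    using assms by (simp add: commuting_row_contraction_def)
  have dilate: "norm (eval_mat p (\<lambda>i. r *\<^sub>R T i) *v x) \<le> ?M * norm x" if r: "0 < r" "r < 1" for r :: real and x
  proof (rule von_neumann_strict_row_contraction)
    show "(r *\<^sub>R T i) ** (r *\<^sub>R T j) = (r *\<^sub>R T j) ** (r *\<^sub>R T i)" for i j
      by (simp add: matrix_scalar_ac comm flip: scalar_matrix_assoc)
    have "mat_adj (r *\<^sub>R T i) *v x = r *\<^sub>R (mat_adj (T i) *v x)" for i x
      by (simp add: mat_adj_def transpose_def vec_eq_iff matrix_vector_mult_def scaleR_sum_right)
    then have "(\<Sum>i\<in>UNIV. (norm (mat_adj (r *\<^sub>R T i) *v x))\<^sup>2) = r\<^sup>2 * (\<Sum>i\<in>UNIV. (norm (mat_adj (T i) *v x))\<^sup>2)" for x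
      by (simp add: power_mult_distrib sum_distrib_left)
    then show "(\<Sum>i\<in>UNIV. (norm (mat_adj (r *\<^sub>R T i) *v x))\<^sup>2) \<le> r\<^sup>2 * (norm x)\<^sup>2" for x
      using commuting_row_contraction_adj_bound[OF assms, of x] by (simp add: mult_left_mono)
    show "r\<^sup>2 < 1" using r by (simp add: power_less_one_iff abs_square_less_1)
  qed
  have "norm (eval_mat p T *v x) \<le> ?M * norm x" for x
  proof (rule tendsto_upperbound)
    show "((\<lambda>r. norm (eval_mat p (\<lambda>i. r *\<^sub>R T i) *v x)) \<longlongrightarrow> norm (eval_mat p T *v x)) (at_left (1::real))"
      by (intro tendsto_norm tendsto_eval_mat_dilation comm)
    show "\<forall>\<^sub>F r in at_left (1::real). norm (eval_mat p (\<lambda>i. r *\<^sub>R T i) *v x) \<le> ?M * norm x"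
      using eventually_at_left_real[of 0 "1::real"] dilate by (auto elim!: eventually_mono)
  qed simp
  then show ?thesis
    unfolding op_norm_def by (rule onorm_le)
qed

end
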